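(* Let $N\ge2$, let $\mathbf k=(k_1,\dots,k_N)$ be positive integers, let $F\subseteq\mathcal E_N$, and suppose $\mu_{\mathbf k}(F)>0$. (i) Any two factors in $\mathfrak E^\circ_{\mathbf k}(F)$ can be joined by a finite sequence of simple alternating-cycle moves such that every intermediate factor remains in $\mathfrak E^\circ_{\mathbf k}(F)$. (ii) Fix $a\in\mathfrak E^\circ_{\mathbf k}(F)$ and a simple cycle $C$ of $\mathcal B(F)$. On every integer interval on which $a+t\gamma_C$ remains positive (on all of $F$), the sequence $t\mapsto w_{\mathbf k}(a+t\gamma_C)$ is strictly log-concave. More precisely, whenever the three factors $a+(t-1)\gamma_C$, $a+t\gamma_C$, $a+(t+1)\gamma_C$ are positive on $F$, $$\frac{w_{\mathbf k}(a+(t+1)\gamma_C)\,w_{\mathbf k}(a+(t-1)\gamma_C)}{w_{\mathbf k}(a+t\gamma_C)^2}=\prod_{e\in C}\frac{a_e+t(\gamma_C)_e}{a_e+t(\gamma_C)_e+1}<1.$$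
   Context: Let $[N]=\{1,\dots,N\}$ and $\mathcal E_N=\{(j,i):1\le i,j\le N,\ j\ne i\}$, with $(j,i)$ written $j\to i$. For $F\subseteq\mathcal E_N$, $\mathfrak E_{\mathbf k}(F)$ is the set of $a\in\mathbb Z_{\ge0}^{\mathcal E_N}$ with $a_e=0$ for $e\notin F$, $\sum_{j\ne i}a_{ji}=k_i$ for all $i$, $\sum_{i\ne j}a_{ji}=k_j$ for all $j$ (balanced $\mathbf k$-factors), and $\mathfrak E^\circ_{\mathbf k}(F)=\{a\in\mathfrak E_{\mathbf k}(F):a_e>0\ \forall e\in F\}$. The weight is $w_{\mathbf k}(a)=\prod_{i=1}^N\frac{k_i!}{\prod_{j\ne i}a_{ji}!}$ and $\mu_{\mathbf k}(F)=\sum_{a\in\mathfrak E^\circ_{\mathbf k}(F)}w_{\mathbf k}(a)$. $\mathcal B(F)$ is the bipartite graph with left vertices $i_L$ and right vertices $j_R$ ($i,j\in[N]$) and an edge $i_Lj_R$ for each $j\to i\in F$ (edges identified with arcs). The edges of a simple cycle $C$ of $\mathcal B(F)$ split into two alternating classes $C^+$, $C^-$; the signed cycle vector $\gamma_C$ is $+1$ on $C^+$, $-1$ on $C^-$, and $0$ off $C$. A simple alternating-cycle move replaces $b$ by $b+n\gamma_C$ for a simple cycle $C$ of $\mathcal B(F)$ and an integer $n$. *)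

theory Defs
  imports Complex_Main
begin

text \<open>The arc \<open>j \<rightarrow> i\<close> is the pair \<open>(j, i)\<close>.\<close>

type_synonym arc = "nat \<times> nat"

definition arcs :: "nat \<Rightarrow> arc set" where
  "arcs N = {(j, i). j \<in> {1..N} \<and> i \<in> {1..N} \<and> j \<noteq> i}"

text \<open>Factors are integer-valued so that signed cycle vectors can be added to them. They are
  functions on all pairs; since they vanish off \<open>F \<subseteq> arcs N\<close>, they are determined by their values
  on \<open>arcs N\<close>.\<close>

definition balanced_factors :: "nat \<Rightarrow> (nat \<Rightarrow> nat) \<Rightarrow> arc set \<Rightarrow> (arc \<Rightarrow> int) set" where
  "balanced_factors N k F =
    {a. (\<forall>e. a e \<ge> 0) \<and> (\<forall>e. e \<notin> F \<longrightarrow> a e = 0) \<and>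
        (\<forall>i\<in>{1..N}. (\<Sum>j\<in>{1..N} - {i}. a (j, i)) = int (k i)) \<and>
        (\<forall>j\<in>{1..N}. (\<Sum>i\<in>{1..N} - {j}. a (j, i)) = int (k j))}"

definition positive_factors :: "nat \<Rightarrow> (nat \<Rightarrow> nat) \<Rightarrow> arc set \<Rightarrow> (arc \<Rightarrow> int) set" where
  "positive_factors N k F = {a \<in> balanced_factors N k F. \<forall>e\<in>F. a e > 0}"

definition weight :: "nat \<Rightarrow> (nat \<Rightarrow> nat) \<Rightarrow> (arc \<Rightarrow> int) \<Rightarrow> real" where
  "weight N k a = (\<Prod>i\<in>{1..N}. fact (k i) / (\<Prod>j\<in>{1..N} - {i}. fact (nat (a (j, i)))))"

definition mu :: "nat \<Rightarrow> (nat \<Rightarrow> nat) \<Rightarrow> arc set \<Rightarrow> real" where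
  "mu N k F = (\<Sum>a\<in>positive_factors N k F. weight N k a)"

text \<open>The sum defining \<open>mu\<close> is a genuine finite sum.\<close>

lemma finite_positive_factors:
  assumes "F \<subseteq> arcs N"
  shows "finite (positive_factors N k F)"
proof -
  let ?K = "\<Sum>i\<in>{1..N}. int (k i)"
  have fin: "finite (arcs N)"
    by (rule finite_subset[of _ "{1..N} \<times> {1..N}"]) (auto simp: arcs_def)
  have "a e \<in> {0..?K}" if a: "a \<in> balanced_factors N k F" and e: "e \<in> arcs N" for a e
  proof -
    obtain j i where ji: "e = (j, i)" "j \<in> {1..N} - {i}" "i \<in> {1..N}"
      using e by (auto simp: arcs_def)
    have nn: "a x \<ge> 0" for x using a unfolding balanced_factors_def by blast
    have "a e \<le> (\<Sum>j\<in>{1..N} - {i}. a (j, i))"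
      unfolding ji(1) by (rule member_le_sum[OF ji(2)]) (use nn in auto)
    also have "\<dots> = int (k i)" using a ji(3) by (simp add: balanced_factors_def)
    also have "\<dots> \<le> ?K" by (rule member_le_sum[OF ji(3)]) auto
    finally show ?thesis using nn by simp
  qed
  moreover have "a e = 0" if "a \<in> balanced_factors N k F" "e \<notin> arcs N" for a e
    using that assms unfolding balanced_factors_def by blast
  ultimately have "positive_factors N k F \<subseteq>
      {a. \<forall>e. (e \<in> arcs N \<longrightarrow> a e \<in> {0..?K}) \<and> (e \<notin> arcs N \<longrightarrow> a e = 0)}"
    unfolding positive_factors_def by blast
  then show ?thesis
    by (rule finite_subset) (rule finite_set_of_finite_funs[OF fin], simp)
qed

datatype vertex = L nat | R nat

fun bip_edge :: "arc \<Rightarrow> vertex set" where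
  "bip_edge (j, i) = {L i, R j}"

text \<open>The bipartite graph is given by its edge set; the possible isolated vertices play no role for
  cycles.\<close>

definition bip_graph :: "arc set \<Rightarrow> vertex set set" where
  "bip_graph F = bip_edge ` F"

text \<open>A simple cycle is represented by its cyclic list of pairwise distinct vertices.
  \<open>cycle_edge C n\<close> is the edge joining the vertices at positions \<open>n\<close> and \<open>n + 1\<close> (cyclically).
  Length at least 3 excludes traversing a single edge back and forth.\<close>

definition cycle_edge :: "vertex list \<Rightarrow> nat \<Rightarrow> vertex set" where
  "cycle_edge C n = {C ! n, C ! (Suc n mod length C)}"

definition simple_cycle :: "vertex set set \<Rightarrow> vertex list \<Rightarrow> bool" where
  "simple_cycle G C \<longleftrightarrow>
    length C \<ge> 3 \<and> distinct C \<and> (\<forall>n<length C. cycle_edge C n \<in> G)"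

text \<open>The edges of a cycle, as arcs. The two alternating classes consist of the edges at even and
  at odd positions; as cycles in a bipartite graph have even length, consecutive edges always lie
  in different classes. Shifting the list by one position exchanges the two classes, so both
  choices of sign of the cycle vector are covered when ranging over all lists.\<close>

definition cycle_arcs :: "vertex list \<Rightarrow> arc set" where
  "cycle_arcs C = {e. \<exists>n<length C. bip_edge e = cycle_edge C n}"

definition cycle_pos :: "vertex list \<Rightarrow> arc set" where
  "cycle_pos C = {e. \<exists>n<length C. even n \<and> bip_edge e = cycle_edge C n}"

definition cycle_neg :: "vertex list \<Rightarrow> arc set" where
  "cycle_neg C = {e. \<exists>n<length C. odd n \<and> bip_edge e = cycle_edge C n}"

definition cycle_vec :: "vertex list \<Rightarrow> arc \<Rightarrow> int" where
  "cycle_vec C e = (if e \<in> cycle_pos C then 1 else if e \<in> cycle_neg C then - 1 else 0)"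

definition shift :: "(arc \<Rightarrow> int) \<Rightarrow> int \<Rightarrow> vertex list \<Rightarrow> arc \<Rightarrow> int" where
  "shift a t C = (\<lambda>e. a e + t * cycle_vec C e)"

definition cycle_move :: "arc set \<Rightarrow> (arc \<Rightarrow> int) \<Rightarrow> (arc \<Rightarrow> int) \<Rightarrow> bool" where
  "cycle_move F b b' \<longleftrightarrow> (\<exists>C n. simple_cycle (bip_graph F) C \<and> b' = shift b n C)"

definition int_interval :: "int set \<Rightarrow> bool" where
  "int_interval I \<longleftrightarrow> (\<forall>x\<in>I. \<forall>y\<in>I. {x..y} \<subseteq> I)"

definition strictly_log_concave_on :: "int set \<Rightarrow> (int \<Rightarrow> real) \<Rightarrow> bool" where
  "strictly_log_concave_on I f \<longleftrightarrow>
    (\<forall>t\<in>I. f t > 0) \<and>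
    (\<forall>t. t - 1 \<in> I \<and> t \<in> I \<and> t + 1 \<in> I \<longrightarrow> f (t + 1) * f (t - 1) < (f t)\<^sup>2)"

end

theory Submission
  imports Defs
begin

text \<open>
  For (i), let \<open>d = b - a\<close>. All sums of \<open>d\<close> over the arcs into or out of a fixed vertex vanish, so
  in the bipartite graph one can walk along arcs with \<open>d > 0\<close> from left to right and along arcs with
  \<open>d < 0\<close> from right to left without ever getting stuck. Such a walk closes up to a simple cycle
  whose signed vector agrees in sign with \<open>d\<close> on its support. Adding this vector to \<open>a\<close> keeps every
  entry between those of \<open>a\<close> and \<open>b\<close>, and brings the factor strictly closer to \<open>b\<close>.

  For (ii), the weight is a constant divided by a product of factorials over all arcs. An arc on the
  cycle with entry \<open>x\<close> contributes \<open>x!\<^sup>2 / ((x + 1)! (x - 1)!) = x / (x + 1)\<close> to the ratio, whichever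
  sign it has, and every other arc contributes \<open>1\<close>.
\<close>

section \<open>Arcs as bipartite edges, and the support of cycle vectors\<close>

lemma finite_arcs: "finite (arcs N)"
  by (rule finite_subset[of _ "{1..N} \<times> {1..N}"]) (auto simp: arcs_def)

text \<open>The tags \<open>L\<close> and \<open>R\<close> let the unordered pair remember which
  endpoint is the head and which the tail; this is what identifies edges with arcs.\<close>

lemma bip_edge_eq_iff: "bip_edge e = {L i, R j} \<longleftrightarrow> e = (j, i)"
  by (cases e) (auto simp: doubleton_eq_iff)

lemma inj_bip_edge: "inj bip_edge"
proof (rule injI)
  fix e e' assume "bip_edge e = bip_edge e'"
  then show "e = e'" by (cases e') (simp add: bip_edge_eq_iff)
qed

lemma cycle_arcs_subset:
  assumes "simple_cycle (bip_graph F) C"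
  shows "cycle_arcs C \<subseteq> F"
proof
  fix e assume "e \<in> cycle_arcs C"
  then obtain n where "n < length C" "bip_edge e = cycle_edge C n"
    unfolding cycle_arcs_def by blast
  with assms have "bip_edge e \<in> bip_edge ` F"
    by (simp add: simple_cycle_def bip_graph_def)
  then show "e \<in> F" by (simp add: inj_image_mem_iff[OF inj_bip_edge])
qed

text \<open>Supplies the arc that makes two later inequalities strict: the weight ratio below 1 and
  the decrease of the distance between factors.\<close>

lemma cycle_arcs_nonempty:
  assumes "simple_cycle (bip_graph F) C"
  shows "cycle_arcs C \<noteq> {}"
proof -
  have "0 < length C" using assms by (auto simp: simple_cycle_def)
  moreover from this obtain e where "bip_edge e = cycle_edge C 0"
    using assms unfolding simple_cycle_def bip_graph_def by (metis imageE)
  ultimately show ?thesis unfolding cycle_arcs_def by blast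
qed

lemma cycle_vec_on_cycle: "e \<in> cycle_arcs C \<Longrightarrow> cycle_vec C e = 1 \<or> cycle_vec C e = - 1"
  by (auto simp: cycle_vec_def cycle_arcs_def cycle_pos_def cycle_neg_def)

lemma cycle_vec_off_cycle: "e \<notin> cycle_arcs C \<Longrightarrow> cycle_vec C e = 0"
  by (auto simp: cycle_vec_def cycle_arcs_def cycle_pos_def cycle_neg_def)

section \<open>Weight ratios along a cycle and strict log-concavity\<close>

text \<open>The pairs of a vertex \<open>i\<close> and some \<open>j\<close> different from it are
  the arcs with their components swapped. With a single product over arcs, a shift along a cycle can
  be compared arc by arc.\<close>

lemma weight_altdef:
  "weight N k a = (\<Prod>i\<in>{1..N}. fact (k i)) / (\<Prod>e\<in>arcs N. fact (nat (a e)))"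
proof -
  have "(\<Prod>i\<in>{1..N}. \<Prod>j\<in>{1..N} - {i}. fact (nat (a (j, i))) :: real)
      = (\<Prod>(i, j)\<in>Sigma {1..N} (\<lambda>i. {1..N} - {i}). fact (nat (a (j, i))))"
    by (rule prod.Sigma) auto
  also have "\<dots> = (\<Prod>e\<in>arcs N. fact (nat (a e)))"
    by (rule prod.reindex_bij_witness[of _ prod.swap prod.swap]) (auto simp: arcs_def)
  finally show ?thesis by (simp add: weight_def prod_dividef)
qed

lemma weight_pos: "weight N k a > 0"
  by (simp add: weight_altdef prod_pos)

lemma fact_ratio:
  assumes "x > 0"
  shows "fact (nat x) * fact (nat x) / (fact (nat (x + 1)) * fact (nat (x - 1)))
           = real_of_int x / real_of_int (x + 1)"
proof -
  \<comment> \<open>With \<open>x\<close> at least 1, none of the three \<open>nat\<close>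
    conversions truncates.\<close>
  obtain m where "x = int (Suc m)"
    using assms by (metis zero_less_imp_eq_int gr0_implies_Suc)
  moreover have "nat (int (Suc m) + 1) = Suc (Suc m)" "nat (int (Suc m) - 1) = m"
    "nat (int (Suc m)) = Suc m"
    by auto
  ultimately show ?thesis by (simp add: divide_simps del: of_nat_Suc)
qed

lemma weight_ratio:
  assumes F: "F \<subseteq> arcs N" and C: "simple_cycle (bip_graph F) C"
    and pos: "\<forall>e\<in>F. shift a t C e > 0"
  shows "weight N k (shift a (t + 1) C) * weight N k (shift a (t - 1) C)
           / (weight N k (shift a t C))\<^sup>2
         = (\<Prod>e\<in>cycle_arcs C. real_of_int (a e + t * cycle_vec C e)
                               / real_of_int (a e + t * cycle_vec C e + 1))"
proof -
  define f :: "int \<Rightarrow> arc \<Rightarrow> real" where "f = (\<lambda>s e. fact (nat (shift a s C e)))"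
  define K :: real where "K = (\<Prod>i\<in>{1..N}. fact (k i))"
  have w: "weight N k (shift a s C) = K / (\<Prod>e\<in>arcs N. f s e)" for s
    by (simp add: weight_altdef K_def f_def)
  have "K \<noteq> 0" "(\<Prod>e\<in>arcs N. f s e) \<noteq> 0" for s
    by (simp_all add: K_def f_def finite_arcs)
  then have "weight N k (shift a (t + 1) C) * weight N k (shift a (t - 1) C)
           / (weight N k (shift a t C))\<^sup>2
      = (\<Prod>e\<in>arcs N. f t e) * (\<Prod>e\<in>arcs N. f t e)
          / ((\<Prod>e\<in>arcs N. f (t + 1) e) * (\<Prod>e\<in>arcs N. f (t - 1) e))"
    unfolding w by (simp add: field_simps power2_eq_square)
  also have "\<dots> = (\<Prod>e\<in>arcs N. f t e * f t e / (f (t + 1) e * f (t - 1) e))"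
    by (simp add: prod.distrib prod_dividef)
  also have "\<dots> = (\<Prod>e\<in>cycle_arcs C. real_of_int (a e + t * cycle_vec C e)
                               / real_of_int (a e + t * cycle_vec C e + 1))"
  proof (rule prod.mono_neutral_cong_right[OF finite_arcs])
    show "cycle_arcs C \<subseteq> arcs N" using cycle_arcs_subset[OF C] F by blast
    show "\<forall>e\<in>arcs N - cycle_arcs C. f t e * f t e / (f (t + 1) e * f (t - 1) e) = 1"
      by (simp add: f_def shift_def cycle_vec_off_cycle)
    fix e assume e: "e \<in> cycle_arcs C"
    define x where "x = a e + t * cycle_vec C e"
    have "x > 0" using pos cycle_arcs_subset[OF C] e by (auto simp: shift_def x_def)
    \<comment> \<open>A sign of -1 only swaps the entries \<open>x + 1\<close> and
      \<open>x - 1\<close>, and the denominator is symmetric in them.\<close>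
    from fact_ratio[OF this] cycle_vec_on_cycle[OF e]
    show "f t e * f t e / (f (t + 1) e * f (t - 1) e)
        = real_of_int (a e + t * cycle_vec C e) / real_of_int (a e + t * cycle_vec C e + 1)"
      by (auto simp: f_def shift_def x_def algebra_simps)
  qed
  finally show ?thesis .
qed

text \<open>Each factor has the form x / (x + 1) with x > 0, hence lies in [0, 1), and there is at
  least one factor.\<close>

lemma cycle_ratio_less_1:
  assumes F: "finite F" and C: "simple_cycle (bip_graph F) C"
    and pos: "\<forall>e\<in>F. shift a t C e > 0"
  shows "(\<Prod>e\<in>cycle_arcs C. real_of_int (a e + t * cycle_vec C e)
                               / real_of_int (a e + t * cycle_vec C e + 1)) < 1"
proof -
  let ?r = "\<lambda>e. real_of_int (a e + t * cycle_vec C e) / real_of_int (a e + t * cycle_vec C e + 1)"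
  have fin: "finite (cycle_arcs C)"
    using cycle_arcs_subset[OF C] F finite_subset by blast
  have r: "0 \<le> ?r e \<and> ?r e < 1" if "e \<in> cycle_arcs C" for e
  proof -
    define x where "x = a e + t * cycle_vec C e"
    have "x > 0" using pos cycle_arcs_subset[OF C] that by (auto simp: shift_def x_def)
    then show ?thesis unfolding x_def[symmetric] by simp
  qed
  obtain e where e: "e \<in> cycle_arcs C" using cycle_arcs_nonempty[OF C] by blast
  have "prod ?r (cycle_arcs C) < prod (\<lambda>_. 1) (cycle_arcs C)"
    by (rule prod_mono_strict[OF e _ fin]) (use r e less_imp_le zero_less_one in blast)+
  then show ?thesis by simp
qed

lemma strictly_log_concave_shift:
  assumes F: "F \<subseteq> arcs N" and C: "simple_cycle (bip_graph F) C"
    and pos: "\<forall>t\<in>I. \<forall>e\<in>F. shift a t C e > 0"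
  shows "strictly_log_concave_on I (\<lambda>t. weight N k (shift a t C))"
  unfolding strictly_log_concave_on_def
proof (intro conjI ballI allI impI)
  fix t assume t: "t - 1 \<in> I \<and> t \<in> I \<and> t + 1 \<in> I"
  then have p: "\<forall>e\<in>F. shift a t C e > 0" using pos by blast
  have "finite F" using F finite_arcs finite_subset by blast
  from cycle_ratio_less_1[OF this C p]
  have "weight N k (shift a (t + 1) C) * weight N k (shift a (t - 1) C)
           / (weight N k (shift a t C))\<^sup>2 < 1"
    unfolding weight_ratio[OF F C p] .
  then show "weight N k (shift a (t + 1) C) * weight N k (shift a (t - 1) C)
           < (weight N k (shift a t C))\<^sup>2"
    using weight_pos[of N k "shift a t C"] by (simp add: divide_less_eq)
qed (rule weight_pos)

section \<open>The cycle vector as a sum over positions\<close>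

text \<open>Two positions sharing an edge would have to traverse it in opposite directions, each
  being the cyclic successor of the other, which length at least 3 rules out. Hence the two
  alternating classes are disjoint.\<close>

lemma inj_on_cycle_edge:
  assumes "distinct C" "length C \<ge> 3"
  shows "inj_on (cycle_edge C) {..<length C}"
proof (rule inj_onI)
  fix m n assume m: "m \<in> {..<length C}" and n: "n \<in> {..<length C}"
    and eq: "cycle_edge C m = cycle_edge C n"
  let ?l = "length C"
  have lt: "Suc m mod ?l < ?l" "Suc n mod ?l < ?l" "m < ?l" "n < ?l"
    using m n by (auto intro!: mod_less_divisor)
  have "m = n \<or> m = Suc n mod ?l \<and> Suc m mod ?l = n"
    using eq assms(1) lt by (auto simp: cycle_edge_def doubleton_eq_iff nth_eq_iff_index_eq)
  then show "m = n"
    using assms(2) lt by (auto simp: mod_Suc split: if_splits)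
qed

text \<open>At most one summand is nonzero, since no edge occurs at two positions. In this form,
  sums over arcs can be exchanged with sums over positions.\<close>

lemma cycle_vec_eq_sum:
  assumes "distinct C" "length C \<ge> 3"
  shows "cycle_vec C e
    = (\<Sum>n<length C. if bip_edge e = cycle_edge C n then (if even n then 1 else - 1) else 0)"
proof (cases "e \<in> cycle_arcs C")
  case True
  then obtain m where m: "m < length C" "bip_edge e = cycle_edge C m"
    by (auto simp: cycle_arcs_def)
  then have eq: "bip_edge e = cycle_edge C n \<longleftrightarrow> n = m" if "n < length C" for n
    using that inj_on_cycle_edge[OF assms] by (auto simp: inj_on_def)
  have "(\<Sum>n<length C. if bip_edge e = cycle_edge C n then (if even n then 1 else - 1) else 0)
      = (\<Sum>n<length C. if n = m then (if even n then 1 else - 1) else (0::int))"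
    by (rule sum.cong) (use eq in auto)
  also have "\<dots> = (if even m then 1 else - 1)" using m by simp
  also have "\<dots> = cycle_vec C e"
    using m eq by (auto simp: cycle_vec_def cycle_pos_def cycle_neg_def)
  finally show ?thesis by simp
next
  case False
  then have "bip_edge e \<noteq> cycle_edge C n" if "n < length C" for n
    using that by (auto simp: cycle_arcs_def)
  then show ?thesis using False by (simp add: cycle_vec_off_cycle)
qed

section \<open>Sign-alternating cycles and the balance of cycle vectors\<close>

text \<open>If all terms had the same weak sign, a zero sum would force each of them to vanish. This
  keeps the alternating walk from getting stuck.\<close>

lemma sum_zero_opposite_signs:
  fixes f :: "'a \<Rightarrow> int"
  assumes "finite A" "sum f A = 0" "x \<in> A"
  shows "f x < 0 \<Longrightarrow> \<exists>y\<in>A. f y > 0" and "f x > 0 \<Longrightarrow> \<exists>y\<in>A. f y < 0"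
proof -
  show "\<exists>y\<in>A. f y > 0" if "f x < 0"
    using sum_nonneg_eq_0_iff[of A "\<lambda>y. - f y"] assms that
    by (force simp: sum_negf not_less)
  show "\<exists>y\<in>A. f y < 0" if "f x > 0"
    using sum_nonneg_eq_0_iff[of A f] assms that by (force simp: not_less)
qed

text \<open>The walk has to close up at a left vertex, so that even positions carry the arcs with
  \<open>d > 0\<close>; this is why the period is minimised over even starting points only.\<close>

lemma alternating_cycle_exists:
  fixes d :: "arc \<Rightarrow> int"
  assumes F: "finite F" and supp': "{e. d e \<noteq> 0} \<subseteq> F"
    and out: "\<forall>j i. d (j, i) < 0 \<longrightarrow> (\<exists>j'. d (j', i) > 0)"
    and inn: "\<forall>j i. d (j, i) > 0 \<longrightarrow> (\<exists>i'. d (j, i') < 0)"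
    and nz: "d e0 \<noteq> 0"
  shows "\<exists>C. simple_cycle (bip_graph F) C \<and>
    (\<forall>n<length C. even n \<longrightarrow>
       (\<exists>i j. C ! n = L i \<and> C ! (Suc n mod length C) = R j \<and> d (j, i) > 0)) \<and>
    (\<forall>n<length C. odd n \<longrightarrow>
       (\<exists>i j. C ! n = R j \<and> C ! (Suc n mod length C) = L i \<and> d (j, i) < 0))"
proof -
  have supp: "e \<in> F" if "d e \<noteq> 0" for e using supp' that by blast
  \<comment> \<open>The choices are meaningful only where a partner of the right sign exists; the
    invariant \<open>walk\<close> below ensures this at every visited vertex.\<close>
  define f where "f = (\<lambda>i. SOME j. d (j, i) > 0)"
  define g where "g = (\<lambda>j. SOME i. d (j, i) < 0)"
  \<comment> \<open>If \<open>d e0\<close> is negative, \<open>out\<close> yields a positive arc at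
    the same left vertex.\<close>
  obtain i0 where i0: "\<exists>j. d (j, i0) > 0"
  proof -
    obtain i j where "e0 = (j, i)" by (cases e0)
    then have "d (j, i) > 0 \<or> d (j, i) < 0" using nz by auto
    then show thesis using that out by blast
  qed
  define step where "step = (\<lambda>x. case x of L i \<Rightarrow> R (f i) | R j \<Rightarrow> L (g j))"
  define v where "v = (\<lambda>n. (step ^^ n) (L i0))"
  have vSuc: "v (Suc n) = step (v n)" for n by (simp add: v_def)
  have f: "d (f i, i) > 0" if "d (j, i) > 0" for i j
    unfolding f_def using that by (rule someI)
  have g: "d (j, g j) < 0" if "d (j, i) < 0" for i j
    unfolding g_def using that by (rule someI)
  have walk: "(\<exists>i. v n = L i \<and> even n \<and> (\<exists>j. d (j, i) > 0)) \<or>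
              (\<exists>j. v n = R j \<and> odd n \<and> (\<exists>i. d (j, i) < 0))" for n
  proof (induction n)
    case 0
    then show ?case using i0 by (simp add: v_def)
  next
    case (Suc n)
    then show ?case
    proof (elim disjE exE conjE)
      fix i j assume i: "v n = L i" "even n" "d (j, i) > 0"
      then have "d (f i, i) > 0" using f by blast
      then show ?thesis using i inn by (auto simp: vSuc step_def)
    next
      fix i j assume i: "v n = R j" "odd n" "d (j, i) < 0"
      then have "d (j, g j) < 0" using g by blast
      then show ?thesis using i out by (auto simp: vSuc step_def)
    qed
  qed
  have even_step: "\<exists>i j. v n = L i \<and> v (Suc n) = R j \<and> d (j, i) > 0" if "even n" for n
    using walk[of n] that by (auto simp: vSuc step_def intro: f)
  have odd_step: "\<exists>i j. v n = R j \<and> v (Suc n) = L i \<and> d (j, i) < 0" if "odd n" for n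
    using walk[of n] that by (auto simp: vSuc step_def intro: g)
  \<comment> \<open>All visited vertices are endpoints of the finitely many edges, so the walk must
    repeat a vertex.\<close>
  have "v n \<in> \<Union> (bip_edge ` F)" for n
  proof (cases "even n")
    case True
    then obtain i j where "v n = L i" "d (j, i) > 0" using even_step by blast
    then show ?thesis using supp[of "(j, i)"] by (force intro: bexI[of _ "(j, i)"])
  next
    case False
    then obtain i j where "v n = R j" "d (j, i) < 0" using odd_step by blast
    then show ?thesis using supp[of "(j, i)"] by (force intro: bexI[of _ "(j, i)"])
  qed
  moreover have "finite (\<Union> (bip_edge ` F))" using F by auto
  ultimately have "\<not> inj v"
    by (metis finite_imageD finite_subset image_subset_iff infinite_UNIV_nat)
  then obtain p q where pq: "p < q" "v p = v q"
    unfolding inj_def by (metis linorder_neqE_nat)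
  define P where "P = (\<lambda>l. l > 0 \<and> (\<exists>p. even p \<and> v (p + l) = v p))"
  have P: "P (s - r)" if "r < s" "v r = v s" for r s
  proof (cases "even r")
    case True
    then show ?thesis using that by (auto simp: P_def intro!: exI[of _ r])
  next
    case False
    \<comment> \<open>The walk is deterministic, so a repetition at an odd start persists one step
      later with the same period.\<close>
    moreover have "v (Suc r) = v (Suc s)" using that by (simp add: vSuc)
    ultimately show ?thesis using that by (auto simp: P_def intro!: exI[of _ "Suc r"])
  qed
  define l where "l = (LEAST l. P l)"
  have "P l" unfolding l_def using P[OF pq] by (rule LeastI)
  then obtain p where l0: "l > 0" and p: "even p" "v (p + l) = v p" by (auto simp: P_def)
  have least: "\<not> P m" if "m < l" for m using that not_less_Least l_def by blast
  have "even (p + l)" using walk[of "p + l"] walk[of p] p by auto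
  then have "even l" using p by simp
  \<comment> \<open>Period 2 would traverse one arc forth and back, so \<open>d\<close> would be
    both positive and negative on it.\<close>
  have "l \<noteq> 2"
  proof
    assume "l = 2"
    obtain i j where "v p = L i" "v (Suc p) = R j" "d (j, i) > 0"
      using even_step p by blast
    moreover obtain i' j' where "v (Suc p) = R j'" "v (Suc (Suc p)) = L i'" "d (j', i') < 0"
      using odd_step[of "Suc p"] p by auto
    ultimately show False using p \<open>l = 2\<close> by simp
  qed
  with l0 \<open>even l\<close> have l3: "l \<ge> 3"
    by (metis One_nat_def Suc_1 Suc_leI le_neq_implies_less numeral_3_eq_3 odd_one)
  define C where "C = map (\<lambda>n. v (p + n)) [0..<l]"
  have len: "length C = l" by (simp add: C_def)
  \<comment> \<open>At \<open>n = l - 1\<close> the index wraps to 0, which is correct because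
    \<open>v (p + l) = v p\<close>.\<close>
  have nth: "C ! n = v (p + n)" "C ! (Suc n mod l) = v (Suc (p + n))" if "n < l" for n
    using that l0 p(2) by (auto simp: C_def mod_Suc)
  \<comment> \<open>A repetition inside the window would give the smaller period
    \<open>s - r\<close>, contradicting minimality of \<open>l\<close>.\<close>
  have "v (p + r) \<noteq> v (p + s)" if "r < s" "s < l" for r s
    using P[of "p + r" "p + s"] least[of "s - r"] that by auto
  then have dist: "distinct C"
    unfolding C_def distinct_map
    by (auto simp: inj_on_def) (metis linorder_neqE_nat)
  have ev: "\<exists>i j. C ! n = L i \<and> C ! (Suc n mod length C) = R j \<and> d (j, i) > 0"
    if "n < length C" "even n" for n
    using even_step[of "p + n"] p(1) that nth[of n] len by auto
  have od: "\<exists>i j. C ! n = R j \<and> C ! (Suc n mod length C) = L i \<and> d (j, i) < 0"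
    if "n < length C" "odd n" for n
    using odd_step[of "p + n"] p(1) that nth[of n] len by auto
  have "cycle_edge C n \<in> bip_graph F" if n: "n < length C" for n
  proof -
    obtain i j where "cycle_edge C n = bip_edge (j, i)" "d (j, i) \<noteq> 0"
      using ev[OF n] od[OF n]
      by (cases "even n") (fastforce simp: cycle_edge_def)+
    then show ?thesis using supp[of "(j, i)"] unfolding bip_graph_def by blast
  qed
  then have "simple_cycle (bip_graph F) C"
    using dist l3 len by (simp add: simple_cycle_def)
  then show ?thesis using ev od by blast
qed

text \<open>Exchanging the summations, each position \<open>n\<close> contributes the difference of the indicators of
  a fixed vertex at positions \<open>n\<close> and \<open>n + 1\<close>, up to a global sign, so the sums telescope around the
  cycle.\<close>

lemma cycle_vec_balanced:
  assumes F: "F \<subseteq> arcs N" and C: "simple_cycle (bip_graph F) C"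
    and ev: "\<forall>n<length C. even n \<longrightarrow> (\<exists>i j. C ! n = L i \<and> C ! (Suc n mod length C) = R j)"
    and od: "\<forall>n<length C. odd n \<longrightarrow> (\<exists>i j. C ! n = R j \<and> C ! (Suc n mod length C) = L i)"
  shows "(\<Sum>j\<in>{1..N} - {i}. cycle_vec C (j, i)) = 0"
    and "(\<Sum>i\<in>{1..N} - {j}. cycle_vec C (j, i)) = 0"
proof -
  let ?l = "length C"
  define s :: "nat \<Rightarrow> int" where "s = (\<lambda>n. if even n then 1 else - 1)"
  \<comment> \<open>Reducing the index modulo the length makes the values at 0 and at the length
    agree, so the telescoping sum vanishes.\<close>
  define h :: "vertex \<Rightarrow> nat \<Rightarrow> int" where "h = (\<lambda>x n. if C ! (n mod ?l) = x then 1 else 0)"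
  have D: "distinct C" "?l \<ge> 3" using C by (auto simp: simple_cycle_def)
  have arc: "\<exists>i j. (j, i) \<in> arcs N \<and> cycle_edge C n = {L i, R j} \<and>
      (if even n then C ! n = L i \<and> C ! (Suc n mod ?l) = R j
       else C ! n = R j \<and> C ! (Suc n mod ?l) = L i)" if n: "n < ?l" for n
  proof -
    have "\<exists>i j. if even n then C ! n = L i \<and> C ! (Suc n mod ?l) = R j
       else C ! n = R j \<and> C ! (Suc n mod ?l) = L i"
      using ev od n by (cases "even n") fastforce+
    then obtain i j where ij: "if even n then C ! n = L i \<and> C ! (Suc n mod ?l) = R j
       else C ! n = R j \<and> C ! (Suc n mod ?l) = L i" by blast
    then have edge: "cycle_edge C n = {L i, R j}"
      by (auto simp: cycle_edge_def split: if_splits)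
    have "cycle_edge C n \<in> bip_edge ` F" using C n by (auto simp: simple_cycle_def bip_graph_def)
    then have "(j, i) \<in> F" using edge bip_edge_eq_iff by (metis imageE)
    then show ?thesis using ij edge F by blast
  qed
  have tele: "(\<Sum>n<?l. h x (Suc n) - h x n) = 0" for x
    unfolding sum_lessThan_telescope by (simp add: h_def)
  have "(\<Sum>j\<in>{1..N} - {i}. cycle_vec C (j, i))
      = (\<Sum>n<?l. \<Sum>j\<in>{1..N} - {i}. if bip_edge (j, i) = cycle_edge C n then s n else 0)"
    unfolding cycle_vec_eq_sum[OF D] s_def by (rule sum.swap)
  \<comment> \<open>The cycle leaves left vertices at even positions and enters them at odd ones, so
    the sign is the decrease of the indicator.\<close>
  also have "\<dots> = (\<Sum>n<?l. - (h (L i) (Suc n) - h (L i) n))"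
  proof (rule sum.cong)
    fix n assume "n \<in> {..<?l}"
    then have n: "n < ?l" by simp
    from arc[OF this] obtain i' j' where e: "(j', i') \<in> arcs N" "cycle_edge C n = {L i', R j'}"
      "if even n then C ! n = L i' \<and> C ! (Suc n mod ?l) = R j'
       else C ! n = R j' \<and> C ! (Suc n mod ?l) = L i'" by blast
    have "(\<Sum>j\<in>{1..N} - {i}. if bip_edge (j, i) = cycle_edge C n then s n else 0)
        = (\<Sum>j\<in>{1..N} - {i}. if j = j' then (if i = i' then s n else 0) else 0)"
      unfolding e(2) bip_edge_eq_iff by (rule sum.cong) auto
    \<comment> \<open>When \<open>i = i'\<close>, the index \<open>j'\<close> is in range because
      \<open>(j', i')\<close> is an arc without loop.\<close>
    also have "\<dots> = (if i = i' then s n else 0)"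
      using e(1) by (auto simp: arcs_def)
    also have "\<dots> = - (h (L i) (Suc n) - h (L i) n)"
      using e(3) n by (auto simp: h_def s_def)
    finally show "(\<Sum>j\<in>{1..N} - {i}. if bip_edge (j, i) = cycle_edge C n then s n else 0)
        = - (h (L i) (Suc n) - h (L i) n)" .
  qed simp
  also have "\<dots> = 0" using tele by (simp only: sum_negf)
  finally show "(\<Sum>j\<in>{1..N} - {i}. cycle_vec C (j, i)) = 0" .
  have "(\<Sum>i\<in>{1..N} - {j}. cycle_vec C (j, i))
      = (\<Sum>n<?l. \<Sum>i\<in>{1..N} - {j}. if bip_edge (j, i) = cycle_edge C n then s n else 0)"
    unfolding cycle_vec_eq_sum[OF D] s_def by (rule sum.swap)
  \<comment> \<open>Right vertices are entered at even positions and left at odd ones, so here the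
    sign is the increase.\<close>
  also have "\<dots> = (\<Sum>n<?l. h (R j) (Suc n) - h (R j) n)"
  proof (rule sum.cong)
    fix n assume "n \<in> {..<?l}"
    then have n: "n < ?l" by simp
    from arc[OF this] obtain i' j' where e: "(j', i') \<in> arcs N" "cycle_edge C n = {L i', R j'}"
      "if even n then C ! n = L i' \<and> C ! (Suc n mod ?l) = R j'
       else C ! n = R j' \<and> C ! (Suc n mod ?l) = L i'" by blast
    have "(\<Sum>i\<in>{1..N} - {j}. if bip_edge (j, i) = cycle_edge C n then s n else 0)
        = (\<Sum>i\<in>{1..N} - {j}. if i = i' then (if j = j' then s n else 0) else 0)"
      unfolding e(2) bip_edge_eq_iff by (rule sum.cong) auto
    also have "\<dots> = (if j = j' then s n else 0)"
      using e(1) by (auto simp: arcs_def)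
    also have "\<dots> = h (R j) (Suc n) - h (R j) n"
      using e(3) n by (auto simp: h_def s_def)
    finally show "(\<Sum>i\<in>{1..N} - {j}. if bip_edge (j, i) = cycle_edge C n then s n else 0)
        = h (R j) (Suc n) - h (R j) n" .
  qed simp
  also have "\<dots> = 0" by (rule tele)
  finally show "(\<Sum>i\<in>{1..N} - {j}. cycle_vec C (j, i)) = 0" .
qed

section \<open>Connectivity of the positive factors\<close>

text \<open>A unit move along a cycle conforming in sign to \<open>b - a\<close> cannot overshoot,
  since a nonzero integer difference has absolute value at least 1.\<close>

lemma cycle_move_towards:
  assumes F: "F \<subseteq> arcs N" and a: "a \<in> positive_factors N k F" and b: "b \<in> positive_factors N k F"
    and ne: "a \<noteq> b"
  obtains a' where "a' \<in> positive_factors N k F" "cycle_move F a a'"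
    "(\<Sum>e\<in>F. \<bar>b e - a' e\<bar>) < (\<Sum>e\<in>F. \<bar>b e - a e\<bar>)"
proof -
  have finF: "finite F" using F finite_arcs finite_subset by blast
  define d where "d = (\<lambda>e. b e - a e)"
  have supp: "e \<in> F" if "d e \<noteq> 0" for e
  proof (rule ccontr)
    assume "e \<notin> F"
    then have "a e = 0" "b e = 0"
      using a b unfolding positive_factors_def balanced_factors_def by blast+
    then show False using that by (simp add: d_def)
  qed
  have in_range: "j \<in> {1..N} - {i}" "i \<in> {1..N} - {j}" if "d (j, i) \<noteq> 0" for i j
    using supp[OF that] F by (auto simp: arcs_def)
  have sums: "(\<Sum>j\<in>{1..N} - {i}. d (j, i)) = 0" "(\<Sum>j\<in>{1..N} - {i}. d (i, j)) = 0"
    if "i \<in> {1..N}" for i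
    using a b that by (auto simp: d_def sum_subtractf positive_factors_def balanced_factors_def)
  have out: "\<exists>j'. d (j', i) > 0" if "d (j, i) < 0" for i j
  proof -
    have "d (j, i) \<noteq> 0" using that by simp
    note r = in_range[OF this]
    show ?thesis
      using sum_zero_opposite_signs(1)[of "{1..N} - {i}" "\<lambda>j. d (j, i)" j] sums(1)[of i] r that
      by auto
  qed
  have inn: "\<exists>i'. d (j, i') < 0" if "d (j, i) > 0" for i j
  proof -
    have "d (j, i) \<noteq> 0" using that by simp
    note r = in_range[OF this]
    show ?thesis
      using sum_zero_opposite_signs(2)[of "{1..N} - {j}" "\<lambda>i. d (j, i)" i] sums(2)[of j] r that
      by auto
  qed
  obtain e0 where "a e0 \<noteq> b e0" using ne by blast
  then have "d e0 \<noteq> 0" by (simp add: d_def)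
  have "\<exists>C. simple_cycle (bip_graph F) C \<and>
    (\<forall>n<length C. even n \<longrightarrow>
       (\<exists>i j. C ! n = L i \<and> C ! (Suc n mod length C) = R j \<and> d (j, i) > 0)) \<and>
    (\<forall>n<length C. odd n \<longrightarrow>
       (\<exists>i j. C ! n = R j \<and> C ! (Suc n mod length C) = L i \<and> d (j, i) < 0))"
  proof (rule alternating_cycle_exists[OF finF])
    show "{e. d e \<noteq> 0} \<subseteq> F" using supp by blast
    show "\<forall>j i. d (j, i) < 0 \<longrightarrow> (\<exists>j'. d (j', i) > 0)" using out by blast
    show "\<forall>j i. d (j, i) > 0 \<longrightarrow> (\<exists>i'. d (j, i') < 0)" using inn by blast
    show "d e0 \<noteq> 0" by fact
  qed
  then obtain C where C: "simple_cycle (bip_graph F) C"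
    and ev: "\<forall>n<length C. even n \<longrightarrow>
       (\<exists>i j. C ! n = L i \<and> C ! (Suc n mod length C) = R j \<and> d (j, i) > 0)"
    and od: "\<forall>n<length C. odd n \<longrightarrow>
       (\<exists>i j. C ! n = R j \<and> C ! (Suc n mod length C) = L i \<and> d (j, i) < 0)"
    by (elim exE conjE)
  have "d e > 0" if e: "e \<in> cycle_pos C" for e
  proof -
    obtain n where n: "n < length C" "even n" "bip_edge e = cycle_edge C n"
      using e unfolding cycle_pos_def by blast
    obtain i j where "C ! n = L i" "C ! (Suc n mod length C) = R j" "d (j, i) > 0"
      using ev n(1,2) by blast
    then show ?thesis using n(3) by (simp add: cycle_edge_def bip_edge_eq_iff)
  qed
  moreover have "d e < 0" if e: "e \<in> cycle_neg C" for e
  proof -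
    obtain n where n: "n < length C" "odd n" "bip_edge e = cycle_edge C n"
      using e unfolding cycle_neg_def by blast
    obtain i j where "C ! n = R j" "C ! (Suc n mod length C) = L i" "d (j, i) < 0"
      using od n(1,2) by blast
    then show ?thesis
      using n(3) by (simp add: cycle_edge_def bip_edge_eq_iff insert_commute[of "R j"])
  qed
  ultimately have conf: "cycle_vec C e = 0 \<or> cycle_vec C e = 1 \<and> d e > 0
      \<or> cycle_vec C e = - 1 \<and> d e < 0" for e
    by (simp add: cycle_vec_def)
  define a' where "a' = shift a 1 C"
  have a': "a' e = a e + cycle_vec C e" for e by (simp add: a'_def shift_def)
  \<comment> \<open>An entry is lowered only where \<open>a e\<close> exceeds \<open>b e\<close>, so
    it stays at least \<open>b e\<close>, which is positive.\<close>
  have a'_pos: "a' e > 0" if "e \<in> F" for e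
  proof -
    have "a e > 0" "b e > 0" using a b that by (auto simp: positive_factors_def)
    then show ?thesis using conf[of e] by (auto simp: a' d_def)
  qed
  have a'_off: "a' e = 0" if "e \<notin> F" for e
  proof -
    have "a e = 0" using a that unfolding positive_factors_def balanced_factors_def by blast
    moreover have "cycle_vec C e = 0" using that cycle_arcs_subset[OF C] cycle_vec_off_cycle by blast
    ultimately show ?thesis by (simp add: a')
  qed
  have "\<forall>n<length C. even n \<longrightarrow> (\<exists>i j. C ! n = L i \<and> C ! (Suc n mod length C) = R j)"
    "\<forall>n<length C. odd n \<longrightarrow> (\<exists>i j. C ! n = R j \<and> C ! (Suc n mod length C) = L i)"
    using ev od by blast+
  note bal = cycle_vec_balanced[OF F C this]
  have nonneg: "a' e \<ge> 0" for e
    using a'_pos[of e] a'_off[of e] by linarith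
  have "a' \<in> positive_factors N k F"
  proof -
    have "(\<Sum>j\<in>{1..N} - {i}. a' (j, i)) = (\<Sum>j\<in>{1..N} - {i}. a (j, i))"
      "(\<Sum>j\<in>{1..N} - {i}. a' (i, j)) = (\<Sum>j\<in>{1..N} - {i}. a (i, j))" for i
      using bal by (simp_all add: a' sum.distrib)
    then show ?thesis
      using a a'_pos a'_off nonneg by (simp add: positive_factors_def balanced_factors_def)
  qed
  moreover have "cycle_move F a a'" using C by (auto simp: cycle_move_def a'_def)
  moreover have "(\<Sum>e\<in>F. \<bar>b e - a' e\<bar>) < (\<Sum>e\<in>F. \<bar>b e - a e\<bar>)"
  proof (rule sum_strict_mono_ex1[OF finF])
    show "\<forall>e\<in>F. \<bar>b e - a' e\<bar> \<le> \<bar>b e - a e\<bar>"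
    proof
      fix e show "\<bar>b e - a' e\<bar> \<le> \<bar>b e - a e\<bar>" using conf[of e] by (auto simp: a' d_def)
    qed
    obtain e where e: "e \<in> cycle_arcs C" using cycle_arcs_nonempty[OF C] by blast
    have "\<bar>b e - a' e\<bar> < \<bar>b e - a e\<bar>"
      using cycle_vec_on_cycle[OF e] conf[of e] by (auto simp: a' d_def)
    then show "\<exists>e\<in>F. \<bar>b e - a' e\<bar> < \<bar>b e - a e\<bar>" using e cycle_arcs_subset[OF C] by blast
  qed
  ultimately show thesis using that by blast
qed

text \<open>Induction on the l1 distance to \<open>b\<close>, which each move towards
  \<open>b\<close> decreases strictly.\<close>

lemma positive_factors_connected:
  assumes F: "F \<subseteq> arcs N" and "a \<in> positive_factors N k F" and b: "b \<in> positive_factors N k F"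
  shows "(\<lambda>x y. x \<in> positive_factors N k F \<and> y \<in> positive_factors N k F \<and> cycle_move F x y)\<^sup>*\<^sup>* a b"
  using assms(2)
proof (induction "nat (\<Sum>e\<in>F. \<bar>b e - a e\<bar>)" arbitrary: a rule: less_induct)
  case less
  show ?case
  proof (cases "a = b")
    case False
    from cycle_move_towards[OF F less.prems b this]
    obtain a' where a': "a' \<in> positive_factors N k F" "cycle_move F a a'"
      "(\<Sum>e\<in>F. \<bar>b e - a' e\<bar>) < (\<Sum>e\<in>F. \<bar>b e - a e\<bar>)"
      by metis
    have "(\<Sum>e\<in>F. \<bar>b e - a' e\<bar>) \<ge> 0" by (simp add: sum_nonneg)
    with a'(3) have "nat (\<Sum>e\<in>F. \<bar>b e - a' e\<bar>) < nat (\<Sum>e\<in>F. \<bar>b e - a e\<bar>)" by linarith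
    from less.hyps[OF this a'(1)] show ?thesis
      by (rule converse_rtranclp_into_rtranclp[rotated]) (use less.prems a' in blast)
  qed simp
qed

section \<open>Connectivity together with log-concavity along cycles\<close>

theorem proposition6p2:
  fixes N :: nat and k :: "nat \<Rightarrow> nat" and F :: "arc set"
  assumes "N \<ge> 2"
    and "\<forall>i\<in>{1..N}. k i > 0"
    and "F \<subseteq> arcs N"
    and "mu N k F > 0"
  shows "(\<forall>a\<in>positive_factors N k F. \<forall>b\<in>positive_factors N k F.
            (\<lambda>x y. x \<in> positive_factors N k F \<and> y \<in> positive_factors N k F \<and> cycle_move F x y)^** a b)
       \<and> (\<forall>a\<in>positive_factors N k F. \<forall>C. simple_cycle (bip_graph F) C \<longrightarrow>
            (\<forall>I. int_interval I \<and> (\<forall>t\<in>I. \<forall>e\<in>F. shift a t C e > 0) \<longrightarrow>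
                 strictly_log_concave_on I (\<lambda>t. weight N k (shift a t C)))
          \<and> (\<forall>t. (\<forall>e\<in>F. shift a (t - 1) C e > 0) \<and> (\<forall>e\<in>F. shift a t C e > 0) \<and>
                 (\<forall>e\<in>F. shift a (t + 1) C e > 0) \<longrightarrow>
                 weight N k (shift a (t + 1) C) * weight N k (shift a (t - 1) C)
                     / (weight N k (shift a t C))\<^sup>2
                   = (\<Prod>e\<in>cycle_arcs C. real_of_int (a e + t * cycle_vec C e)
                                       / real_of_int (a e + t * cycle_vec C e + 1))
               \<and> (\<Prod>e\<in>cycle_arcs C. real_of_int (a e + t * cycle_vec C e)
                                       / real_of_int (a e + t * cycle_vec C e + 1)) < 1))"
proof -
  have "finite F" using assms(3) finite_arcs finite_subset by blast
  note ratio = weight_ratio[OF assms(3)] and less_1 = cycle_ratio_less_1[OF this]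
  show ?thesis
  proof (intro conjI ballI allI impI; (elim conjE)?)
    fix a b assume "a \<in> positive_factors N k F" "b \<in> positive_factors N k F"
    then show "(\<lambda>x y. x \<in> positive_factors N k F \<and> y \<in> positive_factors N k F \<and> cycle_move F x y)\<^sup>*\<^sup>* a b"
      by (rule positive_factors_connected[OF assms(3)])
  next
    fix a C I assume "simple_cycle (bip_graph F) C" "\<forall>t\<in>I. \<forall>e\<in>F. shift a t C e > 0"
    then show "strictly_log_concave_on I (\<lambda>t. weight N k (shift a t C))"
      by (rule strictly_log_concave_shift[OF assms(3)])
  qed (rule ratio less_1; assumption)+
qed

end
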